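(* Let $m,n\in\mathbb N$ with $n>1$, let $f:\mathbb R_{>0}\to\mathbb R_{>0}$ be non-increasing, and let $\{R_\ell\}$ be a countable collection of proper closed real analytic submanifolds of $M_{m,n}(\mathbb R)$. Then $\operatorname{UA}_{m,n}(f)\smallsetminus\bigcup_\ell R_\ell$ is uncountable and dense in $M_{m,n}(\mathbb R)$.
   Context: $M_{m,n}(\mathbb R)\cong\mathbb R^{mn}$ is the space of real $m\times n$ matrices. For $f:\mathbb R_{>0}\to\mathbb R_{>0}$, $A\in M_{m,n}(\mathbb R)$ is $f$-uniform, written $A\in\operatorname{UA}_{m,n}(f)$, if for every sufficiently large $t>0$ there exist $\mathbf{q}\in\mathbb Z^n\smallsetminus\{0\}$ and $\mathbf{p}\in\mathbb Z^m$ with $\|A\mathbf{q}-\mathbf{p}\|\le f(t)$ and $\|\mathbf{q}\|\le t$ (sup norms). *)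

theory Defs
  imports "HOL-Analysis.Analysis"
begin

(* A multi-index assigns an exponent to each coordinate direction; it is pinned to
   "undefined" outside Basis, so that distinct multi-indices give distinct monomials. *)

definition multi_indices :: "('a::euclidean_space \<Rightarrow> nat) set" where
  "multi_indices = (Basis \<rightarrow>\<^sub>E UNIV)"

definition monomial_at :: "('a::euclidean_space \<Rightarrow> nat) \<Rightarrow> 'a \<Rightarrow> real" where
  "monomial_at \<alpha> h = (\<Prod>b\<in>Basis. (h \<bullet> b) ^ \<alpha> b)"

(* Intended for open U. Convergence in the sense of has_sum is unconditional, which in finite
   dimension is absolute convergence, so no order on the multi-indices is needed. *)

definition real_analytic_on ::
    "('a::euclidean_space \<Rightarrow> 'b::euclidean_space) \<Rightarrow> 'a set \<Rightarrow> bool" (infix "real'_analytic'_on" 50)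
  where
  "f real_analytic_on U \<longleftrightarrow>
     (\<forall>x\<in>U. \<exists>r>0. \<exists>c. \<forall>h. norm h < r \<longrightarrow>
        ((\<lambda>\<alpha>. monomial_at \<alpha> h *\<^sub>R c \<alpha>) has_sum f (x + h)) multi_indices)"

definition real_analytic_diffeo ::
    "'a::euclidean_space set \<Rightarrow> 'b::euclidean_space set \<Rightarrow> ('a \<Rightarrow> 'b) \<Rightarrow> ('b \<Rightarrow> 'a) \<Rightarrow> bool" where
  "real_analytic_diffeo U V \<phi> \<psi> \<longleftrightarrow>
     open U \<and> open V \<and> homeomorphism U V \<phi> \<psi> \<and> \<phi> real_analytic_on U \<and> \<psi> real_analytic_on V"

(* Embedded submanifolds without boundary, of a constant dimension k: near each of its points,
   R is straightened by an analytic change of coordinates to a k-dimensional linear subspace. *)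

definition real_analytic_submanifold :: "'a::euclidean_space set \<Rightarrow> bool" where
  "real_analytic_submanifold R \<longleftrightarrow>
     (\<exists>k. \<forall>x\<in>R. \<exists>U V (\<phi> :: 'a \<Rightarrow> 'a) \<psi> S.
        x \<in> U \<and> real_analytic_diffeo U V \<phi> \<psi> \<and> subspace S \<and> dim S = k \<and>
        \<phi> ` (U \<inter> R) = V \<inter> S)"

definition integer_vectors :: "(real ^ 'n) set" where
  "integer_vectors = {v. \<forall>i. v $ i \<in> \<int>}"

(* infnorm is the sup norm, whereas norm would be the Euclidean one. *)

definition UA :: "(real \<Rightarrow> real) \<Rightarrow> (real ^ 'n ^ 'm) set" where
  "UA f = {A. \<forall>\<^sub>F t in at_top.
     \<exists>q \<in> integer_vectors - {0}. \<exists>p \<in> integer_vectors.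
       infnorm (A *v q - p) \<le> f t \<and> infnorm q \<le> t}"

end

theory Submission
  imports Defs "HOL-Complex_Analysis.Cauchy_Integral_Formula"
begin

text \<open>
  If the \<open>j\<close>-th column of \<open>x\<close> has entries in \<open>\<int> / N\<close>, then \<open>x\<close> maps the integer vector
  \<open>N e\<^sub>j\<close> to an integer vector. Nested balls around such matrices are built with
  \<open>j\<close> alternating between different columns: inside the current ball one first replaces another
  column \<open>j'\<close> of \<open>x\<close> by a rational one with denominator \<open>N'\<close>, which leaves column \<open>j\<close> untouched, so
  that all nearby matrices map \<open>N e\<^sub>j\<close> within \<open>f N'\<close> of an integer vector. One then
  moves a little inside the affine space of matrices with the new column \<open>j'\<close> so as to leave the
  next submanifold. This is possible for a suitable choice of the new column, since a closed
  analytic submanifold containing a segment contains the whole line. Singletons also have the latter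
  property, so countably many points can be avoided as well, which gives uncountability.
\<close>

section \<open>Analytic submanifolds along rays\<close>

lemma monomial_at_scaleR:
  "monomial_at \<alpha> (t *\<^sub>R u) = t ^ (\<Sum>b\<in>Basis. \<alpha> b) * monomial_at \<alpha> u"
  by (simp add: monomial_at_def power_mult_distrib prod.distrib power_sum)

text \<open>Grouping the multi-index series by total degree turns it into a power series in
  \<open>t\<close>, since a monomial of degree \<open>n\<close> scales by \<open>t ^ n\<close> along
  the direction \<open>u\<close>.\<close>

lemma real_analytic_on_ray_sums:
  fixes f :: "'a::euclidean_space \<Rightarrow> 'b::euclidean_space"
  assumes "f real_analytic_on U" and "x \<in> U"
  obtains r a where "r > 0" "\<And>t. \<bar>t\<bar> < r \<Longrightarrow> (\<lambda>n. t ^ n *\<^sub>R a n) sums f (x + t *\<^sub>R u)"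
proof -
  obtain r c where r: "r > 0" and c: "\<And>h. norm h < r \<Longrightarrow>
      ((\<lambda>\<alpha>. monomial_at \<alpha> h *\<^sub>R c \<alpha>) has_sum f (x + h)) multi_indices"
    using assms unfolding real_analytic_on_def by meson
  define deg where "deg \<alpha> = (\<Sum>b\<in>Basis. \<alpha> b)" for \<alpha> :: "'a \<Rightarrow> nat"
  define M where "M n = {\<alpha> \<in> multi_indices. deg \<alpha> = n}" for n
  \<comment> \<open>This scale moves \<open>u\<close> into the ball of convergence; the added 1
    covers \<open>u = 0\<close>.\<close>
  define s where "s = r / (2 * (norm u + 1))"
  have s: "s > 0" and s_less: "norm (s *\<^sub>R u) < r"
  proof -
    have nu: "norm u + 1 > 0"
      by (smt (verit) norm_ge_zero)
    then show "s > 0"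
      using r by (simp add: s_def)
    have "s * norm u \<le> s * (norm u + 1)"
      using \<open>s > 0\<close> by simp
    also have "\<dots> = r / 2"
      using nu by (simp add: s_def field_simps)
    finally show "norm (s *\<^sub>R u) < r"
      using r \<open>s > 0\<close> by simp
  qed
  define a where "a n = infsum (\<lambda>\<alpha>. monomial_at \<alpha> u *\<^sub>R c \<alpha>) (M n)" for n
  \<comment> \<open>The vector \<open>u\<close> itself may lie outside the ball of convergence. In a
    fixed degree, homogeneity transfers summability from the scaled vector to
    \<open>u\<close>.\<close>
  have summable: "(\<lambda>\<alpha>. monomial_at \<alpha> u *\<^sub>R c \<alpha>) summable_on M n" for n
  proof -
    have "(\<lambda>\<alpha>. monomial_at \<alpha> (s *\<^sub>R u) *\<^sub>R c \<alpha>) summable_on M n"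
      by (rule summable_on_subset_banach[of _ multi_indices])
        (use c[OF s_less] in \<open>auto simp: summable_on_def M_def\<close>)
    then have "(\<lambda>\<alpha>. inverse (s ^ n) *\<^sub>R (monomial_at \<alpha> (s *\<^sub>R u) *\<^sub>R c \<alpha>)) summable_on M n"
      by (intro summable_on_bounded_linear[OF bounded_linear_scaleR_right])
    moreover have "inverse (s ^ n) *\<^sub>R (monomial_at \<alpha> (s *\<^sub>R u) *\<^sub>R c \<alpha>) = monomial_at \<alpha> u *\<^sub>R c \<alpha>"
      if "\<alpha> \<in> M n" for \<alpha>
      using that s by (simp add: M_def deg_def monomial_at_scaleR)
    ultimately show ?thesis
      by (rule summable_on_cong[THEN iffD1, rotated])
  qed
  show thesis
  proof
    show "s > 0" by fact
    fix t :: real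
    assume t: "\<bar>t\<bar> < s"
    have "norm (t *\<^sub>R u) < r"
      using s_less s t by (smt (verit) mult_right_mono norm_ge_zero norm_scaleR)
    note c[OF this]
    moreover have "bij_betw snd (Sigma UNIV M) (multi_indices :: ('a \<Rightarrow> nat) set)"
      by (rule bij_betwI[where g = "\<lambda>\<alpha>. (deg \<alpha>, \<alpha>)"]) (auto simp: M_def)
    ultimately have "((\<lambda>p. monomial_at (snd p) (t *\<^sub>R u) *\<^sub>R c (snd p)) has_sum f (x + t *\<^sub>R u)) (Sigma UNIV M)"
      using has_sum_reindex_bij_betw[of snd "Sigma UNIV M" multi_indices
          "\<lambda>\<alpha>. monomial_at \<alpha> (t *\<^sub>R u) *\<^sub>R c \<alpha>"] by blast
    moreover have "((\<lambda>\<alpha>. monomial_at (snd (n, \<alpha>)) (t *\<^sub>R u) *\<^sub>R c (snd (n, \<alpha>))) has_sum t ^ n *\<^sub>R a n) (M n)" for n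
    proof -
      have "((\<lambda>\<alpha>. t ^ n *\<^sub>R (monomial_at \<alpha> u *\<^sub>R c \<alpha>)) has_sum t ^ n *\<^sub>R a n) (M n)"
        unfolding a_def by (intro has_sum_scaleR has_sum_infsum summable)
      then show ?thesis
        by (rule has_sum_cong[THEN iffD1, rotated]) (auto simp: M_def deg_def monomial_at_scaleR)
    qed
    ultimately have "((\<lambda>n. t ^ n *\<^sub>R a n) has_sum f (x + t *\<^sub>R u)) UNIV"
      by (rule has_sum_SigmaD)
    then show "(\<lambda>n. t ^ n *\<^sub>R a n) sums f (x + t *\<^sub>R u)"
      by (rule has_sum_imp_sums)
  qed
qed

text \<open>A nonzero power series has at most an isolated zero at 0, so vanishing on one side of 0
  already kills every coefficient. The one-sided form is what the endpoint of a segment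
  provides.\<close>

lemma real_power_series_eq_0:
  fixes a :: "nat \<Rightarrow> real"
  assumes "r > 0" and sums: "\<And>t. \<bar>t\<bar> < r \<Longrightarrow> (\<lambda>n. a n * t ^ n) sums g t"
    and "\<delta> > 0" and zero: "\<And>t. - \<delta> < t \<Longrightarrow> t \<le> 0 \<Longrightarrow> g t = 0"
    and "\<bar>t\<bar> < r"
  shows "g t = 0"
proof -
  have "g 0 = 0"
    using zero \<open>\<delta> > 0\<close> by simp
  have "a n = 0" for n
  proof (rule ccontr)
    assume "a n \<noteq> 0"
    \<comment> \<open>The isolated-zero theorem asks for a nonzero coefficient of positive index, so
      the constant term is excluded first.\<close>
    have "a 0 = g 0"
      using sums[of 0] \<open>r > 0\<close> powser_sums_zero[of a] sums_unique2 by fastforce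
    then have "n > 0"
      using \<open>a n \<noteq> 0\<close> \<open>g 0 = 0\<close> by (cases n) auto
    obtain s where "s > 0" and s: "\<And>z. z \<in> cball 0 s - {0} \<Longrightarrow> g z \<noteq> 0"
      by (rule powser_0_nonzero[of r 0 a g n])
        (use sums \<open>r > 0\<close> \<open>a n \<noteq> 0\<close> \<open>n > 0\<close> \<open>g 0 = 0\<close> in auto)
    have "g (- (min s \<delta> / 2)) \<noteq> 0"
      by (rule s) (use \<open>s > 0\<close> \<open>\<delta> > 0\<close> in \<open>auto simp: dist_norm\<close>)
    then show False
      using zero[of "- (min s \<delta> / 2)"] \<open>s > 0\<close> \<open>\<delta> > 0\<close> by auto
  qed
  then show ?thesis
    using sums[OF \<open>\<bar>t\<bar> < r\<close>] sums_unique2[OF _ sums_zero] by simp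
qed

text \<open>A unique continuation property. Besides closedness and properness it is all that the
  nested construction uses of the sets to be avoided.\<close>

definition ray_closed :: "'a::real_vector set \<Rightarrow> bool" where
  "ray_closed R \<longleftrightarrow>
     (\<forall>x u e. e > 0 \<and> (\<forall>t\<in>{0..e}. x + t *\<^sub>R u \<in> R) \<longrightarrow> (\<forall>t\<ge>0. x + t *\<^sub>R u \<in> R))"

lemma ray_closed_singleton: "ray_closed {c}"
  unfolding ray_closed_def
proof (intro allI impI)
  fix x u :: 'a and e t :: real
  assume *: "e > 0 \<and> (\<forall>t\<in>{0..e}. x + t *\<^sub>R u \<in> {c})"
  \<comment> \<open>Two distinct parameters give the same point, which forces
    \<open>u = 0\<close>.\<close>
  then have "x + 0 *\<^sub>R u = c" "x + e *\<^sub>R u = c"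
    by auto
  then show "x + t *\<^sub>R u \<in> {c}"
    using * by auto
qed

text \<open>In a straightening chart, membership in \<open>R\<close> means that
  \<open>v \<bullet> \<phi>\<close> vanishes for every \<open>v\<close> orthogonal to
  \<open>S\<close>. Along the line these functions are power series in \<open>t\<close> that vanish
  to the left of 0, hence also to the right.\<close>

lemma submanifold_segment_extends:
  fixes R :: "'a::euclidean_space set"
  assumes "real_analytic_submanifold R" and "x \<in> R" and "\<delta> > 0"
    and seg: "\<And>t. - \<delta> < t \<Longrightarrow> t \<le> 0 \<Longrightarrow> x + t *\<^sub>R u \<in> R"
  obtains \<eta> where "\<eta> > 0" "\<And>t. \<bar>t\<bar> < \<eta> \<Longrightarrow> x + t *\<^sub>R u \<in> R"
proof -
  obtain U V and \<phi> :: "'a \<Rightarrow> 'a" and \<psi> S where "x \<in> U" and diffeo: "real_analytic_diffeo U V \<phi> \<psi>"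
    and S: "subspace S" and img: "\<phi> ` (U \<inter> R) = V \<inter> S"
    using assms(1,2) unfolding real_analytic_submanifold_def by meson
  have "open U" and hom: "homeomorphism U V \<phi> \<psi>" and ana: "\<phi> real_analytic_on U"
    using diffeo by (auto simp: real_analytic_diffeo_def)
  have inj: "inj_on \<phi> U"
    using hom by (metis homeomorphism_apply1 inj_on_inverseI)
  have "\<phi> ` U = V"
    using hom by (rule homeomorphism_image1)
  obtain r a where "r > 0" and a: "\<And>t. \<bar>t\<bar> < r \<Longrightarrow> (\<lambda>n. t ^ n *\<^sub>R a n) sums \<phi> (x + t *\<^sub>R u)"
    using real_analytic_on_ray_sums[OF ana \<open>x \<in> U\<close>] by blast
  have "((\<lambda>t. x + t *\<^sub>R u) \<longlongrightarrow> x + 0 *\<^sub>R u) (at 0)"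
    by (intro tendsto_intros)
  then have "eventually (\<lambda>t. x + t *\<^sub>R u \<in> U) (at 0)"
    using \<open>open U\<close> \<open>x \<in> U\<close> by (intro topological_tendstoD) auto
  then obtain d where "d > 0" and d: "\<And>t. \<bar>t\<bar> < d \<Longrightarrow> x + t *\<^sub>R u \<in> U"
    using \<open>x \<in> U\<close> unfolding eventually_at by (auto simp: dist_norm) (metis add.right_neutral scale_zero_left)
  show thesis
  proof
    show "min r d > 0"
      using \<open>r > 0\<close> \<open>d > 0\<close> by simp
    fix t
    assume t: "\<bar>t\<bar> < min r d"
    have "v \<bullet> \<phi> (x + t *\<^sub>R u) = 0" if v: "v \<in> S\<^sup>\<bottom>" for v
    proof (rule real_power_series_eq_0[where r = r and a = "\<lambda>n. v \<bullet> a n" and \<delta> = "min \<delta> d"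
            and g = "\<lambda>t. v \<bullet> \<phi> (x + t *\<^sub>R u)"])
      show "(\<lambda>n. (v \<bullet> a n) * t ^ n) sums (v \<bullet> \<phi> (x + t *\<^sub>R u))" if "\<bar>t\<bar> < r" for t
        using bounded_linear.sums[OF bounded_linear_inner_right a[OF that], of v]
        by (simp add: mult.commute)
      show "v \<bullet> \<phi> (x + t *\<^sub>R u) = 0" if "- min \<delta> d < t" "t \<le> 0" for t
      proof -
        have "x + t *\<^sub>R u \<in> U \<inter> R"
          using that d[of t] seg[of t] by auto
        then have "\<phi> (x + t *\<^sub>R u) \<in> S"
          using img by blast
        then show ?thesis
          using v by (auto simp: orthogonal_comp_def orthogonal_def inner_commute)
      qed
    qed (use \<open>r > 0\<close> \<open>\<delta> > 0\<close> \<open>d > 0\<close> t in auto)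
    then have "\<phi> (x + t *\<^sub>R u) \<in> S\<^sup>\<bottom>\<^sup>\<bottom>"
      by (simp add: orthogonal_comp_def orthogonal_def)
    moreover have xU: "x + t *\<^sub>R u \<in> U"
      using d t by simp
    ultimately have "\<phi> (x + t *\<^sub>R u) \<in> \<phi> ` (U \<inter> R)"
      using img \<open>\<phi> ` U = V\<close> orthogonal_comp_self[OF S] by blast
    \<comment> \<open>Lying in the image of \<open>U \<inter> R\<close> yields membership in
      \<open>R\<close> only because \<open>\<phi>\<close> is injective on \<open>U\<close>.\<close>
    then show "x + t *\<^sub>R u \<in> R"
      using inj xU by (auto dest: inj_onD)
  qed
qed

text \<open>At the first exit time \<open>s\<close>, closedness keeps the point in \<open>R\<close>,
  and the local extension then carries the ray beyond \<open>s\<close>, a contradiction.\<close>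

lemma ray_closed_submanifold:
  fixes R :: "'a::euclidean_space set"
  assumes sub: "real_analytic_submanifold R" and "closed R"
  shows "ray_closed R"
  unfolding ray_closed_def
proof (intro allI impI, rule ccontr)
  fix x u :: 'a and e t :: real
  assume e: "e > 0 \<and> (\<forall>t\<in>{0..e}. x + t *\<^sub>R u \<in> R)" and "0 \<le> t" and t: "x + t *\<^sub>R u \<notin> R"
  define T where "T = {s. 0 \<le> s \<and> x + s *\<^sub>R u \<notin> R}"
  define s where "s = Inf T"
  have "t \<in> T"
    using t \<open>0 \<le> t\<close> by (simp add: T_def)
  have "bdd_below T"
    by (auto simp: T_def intro: bdd_belowI[of _ 0])
  have "s \<ge> e"
    unfolding s_def using e \<open>t \<in> T\<close> by (intro cInf_greatest) (auto simp: T_def not_le[symmetric])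
  have below: "x + q *\<^sub>R u \<in> R" if "0 \<le> q" "q < s" for q
    using that cInf_lower[OF _ \<open>bdd_below T\<close>, of q] by (force simp: T_def s_def)
  have "((\<lambda>q. x + q *\<^sub>R u) \<longlongrightarrow> x + s *\<^sub>R u) (at_left s)"
    by (intro tendsto_intros)
  moreover have "eventually (\<lambda>q. x + q *\<^sub>R u \<in> R) (at_left s)"
    using eventually_at_left_real[of 0 s] \<open>s \<ge> e\<close> e by (auto elim!: eventually_mono intro: below)
  ultimately have sR: "x + s *\<^sub>R u \<in> R"
    by (intro Lim_in_closed_set[OF \<open>closed R\<close> _ trivial_limit_at_left_real])
  have "s > 0"
    using \<open>s \<ge> e\<close> e by simp
  have before: "(x + s *\<^sub>R u) + q *\<^sub>R u \<in> R" if "- s < q" "q \<le> 0" for q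
    using below[of "s + q"] sR that by (cases "q = 0") (auto simp: algebra_simps)
  obtain \<eta> where "\<eta> > 0" and \<eta>: "\<And>q. \<bar>q\<bar> < \<eta> \<Longrightarrow> (x + s *\<^sub>R u) + q *\<^sub>R u \<in> R"
    by (rule submanifold_segment_extends[OF sub sR \<open>s > 0\<close>, of u]) (erule (1) before, rule that)
  have "s + \<eta> \<le> Inf T"
  proof (rule cInf_greatest)
    show "T \<noteq> {}" using \<open>t \<in> T\<close> by auto
    fix q assume q: "q \<in> T"
    then have "s \<le> q"
      using cInf_lower[OF _ \<open>bdd_below T\<close>] by (simp add: s_def)
    then show "s + \<eta> \<le> q"
      using \<eta>[of "q - s"] q by (force simp: T_def algebra_simps)
  qed
  then show False
    using \<open>\<eta> > 0\<close> by (simp add: s_def)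
qed

text \<open>If a whole initial piece of the ray from \<open>y\<close> towards \<open>w\<close> lay
  in \<open>R\<close>, so would \<open>w\<close>, which is the point at parameter 1. Hence
  \<open>R\<close> is left at arbitrarily small parameters, still inside \<open>W\<close>.\<close>

lemma ray_closed_escape:
  fixes R :: "'a::real_normed_vector set"
  assumes "ray_closed R" "open W" "y \<in> W" "w \<notin> R"
  obtains t where "y + t *\<^sub>R (w - y) \<in> W - R"
proof -
  have "((\<lambda>t. y + t *\<^sub>R (w - y)) \<longlongrightarrow> y + 0 *\<^sub>R (w - y)) (at_right 0)"
    by (intro tendsto_intros)
  then have "eventually (\<lambda>t. y + t *\<^sub>R (w - y) \<in> W) (at_right 0)"
    using assms by (intro topological_tendstoD) auto
  then obtain b where "b > 0" and b: "\<And>t. 0 < t \<Longrightarrow> t < b \<Longrightarrow> y + t *\<^sub>R (w - y) \<in> W"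
    by (auto simp: eventually_at_right_field)
  have "\<not> (\<forall>t\<in>{0..b/2}. y + t *\<^sub>R (w - y) \<in> R)"
  proof
    assume "\<forall>t\<in>{0..b/2}. y + t *\<^sub>R (w - y) \<in> R"
    with \<open>b > 0\<close> have "\<forall>t\<ge>0. y + t *\<^sub>R (w - y) \<in> R"
      using assms(1) half_gt_zero unfolding ray_closed_def by blast
    from this[rule_format, of 1] show False
      using \<open>w \<notin> R\<close> by simp
  qed
  then obtain t where t: "0 \<le> t" "t \<le> b/2" "y + t *\<^sub>R (w - y) \<notin> R"
    by auto
  have "y + t *\<^sub>R (w - y) \<in> W"
    using b[of t] t \<open>b > 0\<close> \<open>y \<in> W\<close> by (cases "t = 0") auto
  with t show thesis
    by (intro that) auto
qed

section \<open>The nested construction\<close>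

lemma open_contains_integral_multiple:
  fixes W :: "(real ^ 'n ^ 'm) set"
  assumes "open W" "W \<noteq> {}"
  obtains X N where "X \<in> W" "N > K" "\<And>i j. real N * X $ i $ j \<in> \<int>"
proof -
  have "W \<inter> closure (\<Union>k. \<Union>f \<in> Basis \<rightarrow> \<int>. {\<Sum>i::real^'n^'m \<in> Basis. (f i / 2^k) *\<^sub>R i}) \<noteq> {}"
    using assms closure_dyadic_rationals[where 'a = "real^'n^'m"] by simp
  then obtain k f where f: "f \<in> Basis \<rightarrow> \<int>" and
    W: "(\<Sum>i::real^'n^'m \<in> Basis. (f i / 2^k) *\<^sub>R i) \<in> W"
    using \<open>open W\<close> by (subst (asm) open_Int_closure_eq_empty) auto
  define X where "X = (\<Sum>i::real^'n^'m \<in> Basis. (f i / 2^k) *\<^sub>R i)"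
  show thesis
  proof
    show "X \<in> W" using W by (simp add: X_def)
    \<comment> \<open>Dyadic points are dense and \<open>2 ^ k\<close> is a common denominator of
      the entries; the factor \<open>Suc K\<close> only makes it large.\<close>
    show "2 ^ k * Suc K > K"
      using mult_le_mono1[of 1 "2 ^ k" "Suc K"] by simp
    fix i j
    define b :: "real^'n^'m" where "b = axis i (axis j 1)"
    have b: "b \<in> Basis"
      by (simp add: b_def axis_in_Basis_iff)
    have "X $ i $ j = X \<bullet> b"
      by (simp add: b_def inner_axis)
    also have "\<dots> = f b / 2 ^ k"
      using b by (simp add: X_def inner_sum_left inner_Basis if_distrib cong: if_cong)
    finally have "real (2 ^ k * Suc K) * X $ i $ j = real (Suc K) * f b"
      by (simp add: field_simps)
    moreover have "f b \<in> \<int>"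
      using f b by auto
    ultimately show "real (2 ^ k * Suc K) * X $ i $ j \<in> \<int>"
      by (metis Ints_mult Ints_of_nat)
  qed
qed

lemma nested_step:
  fixes x :: "real ^ 'n ^ 'm"
  assumes "CARD('n) > 1" and "\<And>t. t > 0 \<Longrightarrow> f t > (0::real)"
    and "closed R" "R \<noteq> UNIV" "ray_closed R" and "\<epsilon> > 0"
  obtains y \<delta> j' N' where "\<delta> > 0" "N' > K" "\<And>i. real N' * y $ i $ j' \<in> \<int>"
    "cball y \<delta> \<subseteq> ball x \<epsilon> - R"
    "\<And>A i. A \<in> cball y \<delta> \<Longrightarrow> \<bar>real N * A $ i $ j - real N * x $ i $ j\<bar> \<le> f (real N')"
proof -
  obtain j' where j': "j' \<noteq> j"
    using \<open>CARD('n) > 1\<close> by (metis (full_types) UNIV_eq_I card_1_singleton_iff One_nat_def less_irrefl singleton_iff)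
  obtain w where "w \<notin> R"
    using \<open>R \<noteq> UNIV\<close> by blast
  \<comment> \<open>This shows only that the ball is not contained in \<open>R\<close>; openness of
    the difference then supplies a rational point \<open>X\<close> off \<open>R\<close>.\<close>
  then obtain t where "x + t *\<^sub>R (w - x) \<in> ball x \<epsilon> - R"
    using ray_closed_escape[OF \<open>ray_closed R\<close> open_ball] \<open>\<epsilon> > 0\<close> by (metis centre_in_ball)
  then have "ball x \<epsilon> - R \<noteq> {}" "open (ball x \<epsilon> - R)"
    using \<open>closed R\<close> by auto
  then obtain X N' where X: "X \<in> ball x \<epsilon>" "X \<notin> R" and N': "N' > K"
    and int: "\<And>i j. real N' * X $ i $ j \<in> \<int>"
    using open_contains_integral_multiple[where K = K] by (metis DiffE)
  define y where "y = (\<chi> i k. if k = j' then X $ i $ k else x $ i $ k)"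
  have "norm (y - x) \<le> norm (X - x)"
    by (intro norm_le_componentwise_cart) (auto simp: y_def)
  then have "y \<in> ball x \<epsilon>"
    using X by (simp add: dist_norm norm_minus_commute)
  \<comment> \<open>At \<open>y\<close> the left-hand sides are 0, because column \<open>j\<close>
    is still that of \<open>x\<close>. Positivity of \<open>f\<close> thus makes \<open>W\<close> an
    open neighbourhood of \<open>y\<close>.\<close>
  define W where "W = ball x \<epsilon> \<inter> (\<Inter>i. {A. \<bar>real N * A $ i $ j - real N * x $ i $ j\<bar> < f (real N')})"
  have "open W"
    unfolding W_def by (intro open_Int open_ball open_INT finite ballI open_Collect_less continuous_intros)
  have "y \<in> W"
    using \<open>y \<in> ball x \<epsilon>\<close> j' N' assms(2)[of "real N'"] by (auto simp: W_def y_def)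
  \<comment> \<open>The target \<open>X\<close> lies off \<open>R\<close> and shares column
    \<open>j'\<close> with \<open>y\<close>, so that column stays rational all along the
    line.\<close>
  obtain t where t: "y + t *\<^sub>R (X - y) \<in> W - R"
    using ray_closed_escape[OF \<open>ray_closed R\<close> \<open>open W\<close> \<open>y \<in> W\<close> \<open>X \<notin> R\<close>] by blast
  define z where "z = y + t *\<^sub>R (X - y)"
  have "open (W - R)"
    using \<open>open W\<close> \<open>closed R\<close> by auto
  then obtain \<delta> where "\<delta> > 0" and \<delta>: "cball z \<delta> \<subseteq> W - R"
    using t open_contains_cball unfolding z_def by blast
  show thesis
  proof (rule that[of \<delta> N' z j'])
    show "real N' * z $ i $ j' \<in> \<int>" for i
      using int by (simp add: z_def y_def)
    show "cball z \<delta> \<subseteq> ball x \<epsilon> - R"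
      using \<delta> by (auto simp: W_def)
    show "\<bar>real N * A $ i $ j - real N * x $ i $ j\<bar> \<le> f (real N')" if "A \<in> cball z \<delta>" for A i
    proof -
      have "A \<in> W"
        using that \<delta> by blast
      then show ?thesis
        unfolding W_def by (simp add: less_imp_le)
    qed
  qed fact+
qed

section \<open>Uniform approximability of the limit matrix\<close>

lemma infnorm_le_cart:
  fixes v :: "real ^ 'n"
  assumes "\<And>i. \<bar>v $ i\<bar> \<le> c"
  shows "infnorm v \<le> c"
  unfolding infnorm_cart using assms by (intro cSup_least) auto

text \<open>For \<open>N l \<le> t < N (Suc l)\<close> the vector with single entry
  \<open>N l\<close> at position \<open>j l\<close> works: its error is at most
  \<open>f (N (Suc l))\<close>, which is at most \<open>f t\<close> by monotonicity.\<close>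

lemma UA_memI:
  fixes A :: "real ^ 'n ^ 'm"
  assumes "antimono_on {0<..} f" and "\<And>k. N k > k"
    and int: "\<And>k i. real (N k) * x k $ i $ j k \<in> \<int>"
    and le: "\<And>k i. \<bar>real (N k) * A $ i $ j k - real (N k) * x k $ i $ j k\<bar> \<le> f (real (N (Suc k)))"
  shows "A \<in> UA f"
proof -
  have "\<exists>q \<in> integer_vectors - {0}. \<exists>p \<in> integer_vectors.
       infnorm (A *v q - p) \<le> f t \<and> infnorm q \<le> t" if t: "real (N 0) \<le> t" for t
  proof -
    \<comment> \<open>As \<open>N\<close> is not assumed monotone, minimality of \<open>k\<close> is
      what gives \<open>N l \<le> t\<close> for its predecessor \<open>l\<close>.\<close>
    define k where "k = (LEAST k. t < real (N k))"
    obtain k0 :: nat where "t < real k0"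
      using reals_Archimedean2 by blast
    then have "t < real (N k0)"
      using assms(2)[of k0] by linarith
    then have k: "t < real (N k)"
      unfolding k_def by (rule LeastI)
    then obtain l where l: "k = Suc l"
      using t by (cases k) auto
    have "real (N l) \<le> t"
      using not_less_Least[of l "\<lambda>k. t < real (N k)"] l by (simp add: k_def)
    have "N l > 0"
      using assms(2)[of l] by simp
    then have "t > 0"
      using \<open>real (N l) \<le> t\<close> by linarith
    have "f (real (N k)) \<le> f t"
      using monotone_onD[OF assms(1), of t "real (N k)"] k \<open>t > 0\<close> by simp
    define q :: "real ^ 'n" where "q = axis (j l) (real (N l))"
    define p :: "real ^ 'm" where "p = (\<chi> i. real (N l) * x l $ i $ j l)"
    have "(A *v q) $ i = real (N l) * A $ i $ j l" for i
      by (simp add: q_def matrix_vector_mult_def axis_def if_distrib mult.commute cong: if_cong)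
    then have "infnorm (A *v q - p) \<le> f t"
      using le[of l] \<open>f (real (N k)) \<le> f t\<close> l
      by (intro infnorm_le_cart) (auto simp: p_def intro: order_trans)
    moreover have "infnorm q \<le> t"
      using \<open>real (N l) \<le> t\<close> \<open>t > 0\<close> by (intro infnorm_le_cart) (auto simp: q_def axis_def)
    moreover have "q \<in> integer_vectors - {0}"
      using \<open>N l > 0\<close> by (auto simp: q_def integer_vectors_def axis_def vec_eq_iff)
    moreover have "p \<in> integer_vectors"
      using int by (simp add: p_def integer_vectors_def)
    ultimately show ?thesis
      by blast
  qed
  then show ?thesis
    unfolding UA_def eventually_at_top_linorder by blast
qed

lemma UA_avoids_ray_closed:
  fixes f :: "real \<Rightarrow> real" and R :: "nat \<Rightarrow> (real ^ 'n ^ 'm) set"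
  assumes card: "CARD('n) > 1" and pos: "\<And>t. t > 0 \<Longrightarrow> f t > 0" and mono: "antimono_on {0<..} f"
    and R: "\<And>k. closed (R k)" "\<And>k. R k \<noteq> UNIV" "\<And>k. ray_closed (R k)"
    and W: "open W" "W \<noteq> {}"
  shows "\<exists>A\<in>W. A \<in> UA f \<and> (\<forall>k. A \<notin> R k)"
proof -
  \<comment> \<open>A state records centre, radius, rational column and its denominator. The
    relation \<open>Q\<close> bounds the error in the old column by \<open>f\<close> at the new
    denominator, as \<open>UA_memI\<close> demands.\<close>
  define P :: "nat \<Rightarrow> (real^'n^'m) \<times> real \<times> 'n \<times> nat \<Rightarrow> bool" where
    "P k = (\<lambda>(x, \<epsilon>, j, N). \<epsilon> > 0 \<and> cball x \<epsilon> \<subseteq> W \<and> N > k \<and> (\<forall>i. real N * x $ i $ j \<in> \<int>))" for k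
  define Q :: "nat \<Rightarrow> (real^'n^'m) \<times> real \<times> 'n \<times> nat \<Rightarrow> (real^'n^'m) \<times> real \<times> 'n \<times> nat \<Rightarrow> bool" where
    "Q k = (\<lambda>(x, \<epsilon>, j, N) (x', \<epsilon>', j', N'). cball x' \<epsilon>' \<subseteq> ball x \<epsilon> - R k \<and>
       (\<forall>A\<in>cball x' \<epsilon>'. \<forall>i. \<bar>real N * A $ i $ j - real N * x $ i $ j\<bar> \<le> f (real N')))" for k
  have "\<exists>\<sigma>. P 0 \<sigma>"
  proof -
    obtain X N where "X \<in> W" "N > 0" "\<And>i j. real N * X $ i $ j \<in> \<int>"
      using open_contains_integral_multiple[OF W] by blast
    moreover obtain \<epsilon> where "\<epsilon> > 0" "cball X \<epsilon> \<subseteq> W"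
      using \<open>open W\<close> \<open>X \<in> W\<close> open_contains_cball by blast
    ultimately have "P 0 (X, \<epsilon>, j, N)" for j
      by (simp add: P_def)
    then show ?thesis by blast
  qed
  moreover have "\<exists>\<sigma>'. P (Suc k) \<sigma>' \<and> Q k \<sigma> \<sigma>'" if "P k \<sigma>" for k \<sigma>
  proof -
    obtain x :: "real^'n^'m" and \<epsilon> j N where \<sigma>: "\<sigma> = (x, \<epsilon>, j, N)"
      by (cases \<sigma>)
    have "\<epsilon> > 0" and sub: "cball x \<epsilon> \<subseteq> W"
      using that by (auto simp: \<sigma> P_def)
    obtain y :: "real^'n^'m" and \<delta> j' N' where *: "\<delta> > 0" "N' > Suc k" "\<And>i. real N' * y $ i $ j' \<in> \<int>"
      "cball y \<delta> \<subseteq> ball x \<epsilon> - R k"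
      "\<And>A i. A \<in> cball y \<delta> \<Longrightarrow> \<bar>real N * A $ i $ j - real N * x $ i $ j\<bar> \<le> f (real N')"
      by (rule nested_step[OF card _ R(1)[of k] R(2)[of k] R(3)[of k] \<open>\<epsilon> > 0\<close>,
            where K = "Suc k" and N = N and j = j and x = x and f = f]) (erule pos, rule that)
    have "cball y \<delta> \<subseteq> W"
      using *(4) sub ball_subset_cball by blast
    with * have "P (Suc k) (y, \<delta>, j', N') \<and> Q k \<sigma> (y, \<delta>, j', N')"
      by (auto simp: P_def Q_def \<sigma>)
    then show ?thesis by blast
  qed
  ultimately obtain \<sigma> where \<sigma>: "\<And>k. P k (\<sigma> k)" "\<And>k. Q k (\<sigma> k) (\<sigma> (Suc k))"
    using dependent_nat_choice[of P Q] by blast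
  define x \<epsilon> j N where "x k = fst (\<sigma> k)" and "\<epsilon> k = fst (snd (\<sigma> k))"
    and "j k = fst (snd (snd (\<sigma> k)))" and "N k = snd (snd (snd (\<sigma> k)))" for k
  have \<sigma>_eq: "\<sigma> k = (x k, \<epsilon> k, j k, N k)" for k
    by (simp add: x_def \<epsilon>_def j_def N_def)
  have P: "\<epsilon> k > 0" "cball (x k) (\<epsilon> k) \<subseteq> W" "N k > k" "real (N k) * x k $ i $ j k \<in> \<int>" for k i
    using \<sigma>(1)[of k] by (auto simp: P_def \<sigma>_eq)
  have Q: "cball (x (Suc k)) (\<epsilon> (Suc k)) \<subseteq> ball (x k) (\<epsilon> k) - R k"
    "A \<in> cball (x (Suc k)) (\<epsilon> (Suc k)) \<Longrightarrow>
       \<bar>real (N k) * A $ i $ j k - real (N k) * x k $ i $ j k\<bar> \<le> f (real (N (Suc k)))" for k i A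
    using \<sigma>(2)[of k] by (auto simp: Q_def \<sigma>_eq)
  \<comment> \<open>Compactness gives a common point without any need for the radii to tend to
    0.\<close>
  have "\<Inter>(range (\<lambda>k. cball (x k) (\<epsilon> k))) \<noteq> {}"
  proof (rule compact_nest)
    show "cball (x n) (\<epsilon> n) \<subseteq> cball (x m) (\<epsilon> m)" if "m \<le> n" for m n
      by (rule lift_Suc_antimono_le[OF _ that]) (use Q(1) ball_subset_cball in blast)
  qed (use P(1) in \<open>auto simp: not_less intro: less_imp_le\<close>)
  then obtain A where A: "\<And>k. A \<in> cball (x k) (\<epsilon> k)"
    by blast
  have "A \<in> UA f"
    by (rule UA_memI[OF mono P(3,4) Q(2)[OF A]])
  moreover have "A \<in> W" "\<And>k. A \<notin> R k"
    using A P(2) Q(1) by blast+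
  ultimately show ?thesis by blast
qed

theorem theorem3p3:
  fixes f :: "real \<Rightarrow> real"
    and \<R> :: "(real ^ 'n ^ 'm) set set"
  assumes "CARD('n) > 1"
    and "\<And>t. t > 0 \<Longrightarrow> f t > 0"
    and "antimono_on {0<..} f"
    and "countable \<R>"
    and "\<And>R. R \<in> \<R> \<Longrightarrow> real_analytic_submanifold R \<and> closed R \<and> R \<noteq> UNIV"
  shows "uncountable ((UA f :: (real ^ 'n ^ 'm) set) - \<Union>\<R>)
    \<and> closure ((UA f :: (real ^ 'n ^ 'm) set) - \<Union>\<R>) = UNIV"
proof -
  let ?U = "(UA f :: (real ^ 'n ^ 'm) set) - \<Union>\<R>"
  \<comment> \<open>The countable set \<open>C\<close> serves both claims: \<open>C = ?U\<close>
    would leave nothing if \<open>?U\<close> were countable, and \<open>C = {}\<close> gives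
    density.\<close>
  have meets: "W \<inter> (?U - C) \<noteq> {}" if "countable C" and W: "open W" "W \<noteq> {}" for C W
  proof -
    \<comment> \<open>The empty set, vacuously \<open>ray_closed\<close>, ensures that
      \<open>F\<close> is nonempty and can be enumerated by \<open>from_nat_into\<close>.\<close>
    define F where "F = insert {} (\<R> \<union> (\<lambda>c. {c}) ` C)"
    have F: "closed R \<and> R \<noteq> UNIV \<and> ray_closed R" if "R \<in> F" for R
    proof -
      have "{c} \<noteq> (UNIV :: (real ^ 'n ^ 'm) set)" for c
        using not_bounded_UNIV[where 'a = "real ^ 'n ^ 'm"] bounded_insert[of c "{}"] by force
      then show ?thesis
        using that assms(5) ray_closed_submanifold
        by (auto simp: F_def ray_closed_singleton) (auto simp: ray_closed_def)
    qed
    have "countable F" "F \<noteq> {}"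
      using assms(4) \<open>countable C\<close> by (auto simp: F_def)
    then have "range (from_nat_into F) = F"
      by simp
    have "\<exists>A\<in>W. A \<in> UA f \<and> (\<forall>k. A \<notin> from_nat_into F k)"
      by (rule UA_avoids_ray_closed[OF assms(1-3)])
        (use F[OF from_nat_into[OF \<open>F \<noteq> {}\<close>]] W in auto)
    then obtain A where "A \<in> W" "A \<in> UA f" and A: "\<And>R. R \<in> F \<Longrightarrow> A \<notin> R"
      using \<open>range (from_nat_into F) = F\<close> by (metis rangeE)
    moreover have "A \<notin> C"
      using A[of "{A}"] by (auto simp: F_def)
    ultimately show ?thesis
      by (auto simp: F_def)
  qed
  have "uncountable ?U"
    using meets[of ?U UNIV] by auto
  moreover have "closure ?U = UNIV"
    using meets[of "{}" "- closure ?U"] open_Int_closure_eq_empty[of "- closure ?U" ?U] by auto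
  ultimately show ?thesis ..
qed

end
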